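(* (a) Let $4\le n<\infty$ and $q=e^{\pi i/n}$. Up to equivalence there is a unique cell system on the graph $\mathcal{A}^{(n)}$ (with Perron-Frobenius eigenvalue $[3]_q$ and the eigenvector $\phi$ given in the context), namely $$W_{\triangle(k,m)}=\frac{\sqrt{[k+1][k+2][m+1][m+2][k+m+2][k+m+3]}}{[2]},$$ $$W_{\nabla(k,m)}=\frac{\sqrt{[k+1][k+2][m+1][m+2][k+m+3][k+m+4]}}{[2]},$$ for all integers $k,m\ge 0$ for which the triangle $\triangle(k,m)$, respectively $\nabla(k,m)$, lies in $\mathcal{A}^{(n)}$. (b) For the infinite graph $\mathcal{A}^{(\infty)}$ with Perron-Frobenius eigenvalue $\alpha\ge 3$, a cell system is given by the same formulas, for all $k,m\ge 0$, with $[j]$ replaced by $[j]_q$, where $q=e^x$ for any $x\in\mathbb{R}$ with $\alpha=[3]_q$.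
   Context: Quantum numbers: $[m]=[m]_q=(q^m-q^{-m})/(q-q^{-1})$ (with $[m]_1=m$). The graph $\mathcal{A}^{(\infty)}$ has vertices $(\lambda_1,\lambda_2)$, $\lambda_1,\lambda_2\ge 0$ integers, and directed edges $(\lambda_1,\lambda_2)\to(\lambda_1+1,\lambda_2)$, $(\lambda_1,\lambda_2)\to(\lambda_1-1,\lambda_2+1)$, $(\lambda_1,\lambda_2)\to(\lambda_1,\lambda_2-1)$ whenever the target is a vertex. $\mathcal{A}^{(n)}$ is the full subgraph on the vertices with $\lambda_1+\lambda_2\le n-3$. The Perron-Frobenius eigenvector (eigenvalue $[3]_q$) used is $\phi_{(\lambda_1,\lambda_2)}=[\lambda_1+1]_q[\lambda_2+1]_q[\lambda_1+\lambda_2+2]_q/[2]_q$, with $q=e^{\pi i/n}$ for $\mathcal{A}^{(n)}$ and $q=e^x$ for $\mathcal{A}^{(\infty)}$. $\triangle(k,m)$ is the triangle $(k,m)\to(k+1,m)\to(k,m+1)\to(k,m)$, and $\nabla(k,m)$ is the triangle $(k+1,m)\to(k,m+1)\to(k+1,m+1)\to(k+1,m)$; $W_{\triangle(k,m)}$, $W_{\nabla(k,m)}$ denote the values of $W$ on them. Cell systems: let $\mathcal{G}$ be a directed graph (loops and multiple edges allowed), with source and range maps $s,r$, Perron-Frobenius eigenvalue $[3]$ and positive Perron-Frobenius eigenvector $(\phi_i)$. A triangle $\triangle_{ijk}^{(\alpha\beta\gamma)}$ is a closed path $i\xrightarrow{\alpha}j\xrightarrow{\beta}k\xrightarrow{\gamma}i$,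 considered up to cyclic rotation. A cell system $W$ assigns to each triangle a complex number $W(\triangle_{ijk}^{(\alpha\beta\gamma)})$ such that: (I) for all edges $\alpha,\alpha'$ from $i$ to $j$, $\sum_{k,\beta,\gamma}W(\triangle_{ijk}^{(\alpha\beta\gamma)})\overline{W(\triangle_{ijk}^{(\alpha'\beta\gamma)})}=\delta_{\alpha,\alpha'}[2]\phi_i\phi_j$, the sum being over vertices $k$ and edges $\beta:j\to k$, $\gamma:k\to i$; (II) for all edges $\alpha_1,\dots,\alpha_4$ with $s(\alpha_1)=s(\alpha_4)=i_1$, $r(\alpha_1)=r(\alpha_2)=i_2$, $s(\alpha_2)=s(\alpha_3)=i_3$, $r(\alpha_3)=r(\alpha_4)=i_4$, $$\sum\phi_k^{-1}W(\triangle_{i_1i_2k}^{(\alpha_1\beta_1\beta_2)})\overline{W(\triangle_{i_3i_2k}^{(\alpha_2\beta_1\beta_3)})}W(\triangle_{i_3i_4k}^{(\alpha_3\beta_4\beta_3)})\overline{W(\triangle_{i_1i_4k}^{(\alpha_4\beta_4\beta_2)})}=\delta_{\alpha_1,\alpha_4}\delta_{\alpha_2,\alpha_3}\phi_{i_1}\phi_{i_2}\phi_{i_3}+\delta_{\alpha_1,\alpha_2}\delta_{\alpha_3,\alpha_4}\phi_{i_1}\phi_{i_2}\phi_{i_4},$$ the sum being over vertices $k$ and edges $\beta_1:i_2\to k$, $\beta_2:k\to i_1$, $\beta_3:k\to i_3$, $\beta_4:i_4\to k$. Two cell systems $W_1,W_2$ on $\mathcal{G}$ are equivalent if for each pair of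 adjacent vertices $i,j$ there is a unitary matrix $(u(\sigma,\sigma'))$ indexed by the edges from $i$ to $j$ such that for every triangle $W_1(\triangle_{ijk}^{(\sigma\rho\gamma)})=\sum_{\sigma',\rho',\gamma'}u(\sigma,\sigma')u(\rho,\rho')u(\gamma,\gamma')W_2(\triangle_{ijk}^{(\sigma'\rho'\gamma')})$, summing over edges $\sigma':i\to j$, $\rho':j\to k$, $\gamma':k\to i$. *)

theory Defs
  imports Complex_Main "Graph_Theory.Digraph_Component"
begin

text \<open>Quantum numbers are taken in the complex numbers, because \<open>q\<close> is a root of unity for the finite
  graphs. The case \<open>q = 1\<close> has to be separated since the quotient would be \<open>0 / 0 = 0\<close>.\<close>

definition qnum :: "complex \<Rightarrow> nat \<Rightarrow> complex" where
  "qnum q m = (if q = 1 then of_nat m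
     else (q ^ m - inverse q ^ m) / (q - inverse q))"

definition arcs_between :: "('a, 'b) pre_digraph \<Rightarrow> 'a \<Rightarrow> 'a \<Rightarrow> 'b set" where
  "arcs_between G i j = {e \<in> arcs G. tail G e = i \<and> head G e = j}"

text \<open>A closed path of length three, given by its edges, with a marked starting vertex.\<close>

definition triangles :: "('a, 'b) pre_digraph \<Rightarrow> ('b \<times> 'b \<times> 'b) set" where
  "triangles G = {(\<alpha>, \<beta>, \<gamma>). \<exists>i j k.
     \<alpha> \<in> arcs_between G i j \<and> \<beta> \<in> arcs_between G j k \<and> \<gamma> \<in> arcs_between G k i}"

text \<open>\<open>\<mu>\<close> is an eigenvalue of the adjacency matrix (entry \<open>(i, j)\<close>: number of edges from \<open>i\<close> to \<open>j\<close>)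
  with eigenvector \<open>\<psi>\<close>; only the values of \<open>\<psi>\<close> on the vertices matter.\<close>

definition adj_eigen :: "('a, 'b) pre_digraph \<Rightarrow> complex \<Rightarrow> ('a \<Rightarrow> complex) \<Rightarrow> bool" where
  "adj_eigen G \<mu> \<psi> \<longleftrightarrow> (\<exists>i\<in>verts G. \<psi> i \<noteq> 0) \<and>
     (\<forall>i\<in>verts G. (\<Sum>e\<in>out_arcs G i. \<psi> (head G e)) = \<mu> * \<psi> i)"

text \<open>A Perron-Frobenius eigenvector is a positive eigenvector. For a finite graph its eigenvalue is
  required to be the largest one in modulus; an infinite graph may have positive eigenvectors
  for many eigenvalues, and any of them is then called a Perron-Frobenius eigenvalue.\<close>

definition perron_frobenius :: "('a, 'b) pre_digraph \<Rightarrow> complex \<Rightarrow> ('a \<Rightarrow> complex) \<Rightarrow> bool" where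
  "perron_frobenius G a \<phi> \<longleftrightarrow> adj_eigen G a \<phi> \<and>
     (\<forall>i\<in>verts G. \<phi> i \<in> \<real> \<and> 0 < Re (\<phi> i)) \<and>
     (finite (verts G) \<longrightarrow> (\<forall>\<mu> \<psi>. adj_eigen G \<mu> \<psi> \<longrightarrow> cmod \<mu> \<le> cmod a))"

text \<open>\<open>W\<close> is a function of triples of edges; only its values on triangles matter. Local finiteness
  makes all the sums below finite.\<close>

locale cell_system = wf_digraph G for G :: "('a, 'b) pre_digraph" +
  fixes q :: complex and \<phi> :: "'a \<Rightarrow> complex" and W :: "'b \<times> 'b \<times> 'b \<Rightarrow> complex"
  assumes locally_finite:
      "\<And>i. i \<in> verts G \<Longrightarrow> finite (out_arcs G i) \<and> finite (in_arcs G i)"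
    and pf: "perron_frobenius G (qnum q 3) \<phi>"
    and rotate:
      "\<And>\<alpha> \<beta> \<gamma>. (\<alpha>, \<beta>, \<gamma>) \<in> triangles G \<Longrightarrow> W (\<beta>, \<gamma>, \<alpha>) = W (\<alpha>, \<beta>, \<gamma>)"
    and type_I:
      "\<And>i j \<alpha> \<alpha>'. \<alpha> \<in> arcs_between G i j \<Longrightarrow> \<alpha>' \<in> arcs_between G i j \<Longrightarrow>
        (\<Sum>(k, \<beta>, \<gamma>) \<in> {(k, \<beta>, \<gamma>). \<beta> \<in> arcs_between G j k \<and> \<gamma> \<in> arcs_between G k i}.
            W (\<alpha>, \<beta>, \<gamma>) * cnj (W (\<alpha>', \<beta>, \<gamma>)))
          = of_bool (\<alpha> = \<alpha>') * qnum q 2 * \<phi> i * \<phi> j"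
    and type_II:
      "\<And>i\<^sub>1 i\<^sub>2 i\<^sub>3 i\<^sub>4 \<alpha>\<^sub>1 \<alpha>\<^sub>2 \<alpha>\<^sub>3 \<alpha>\<^sub>4.
        \<alpha>\<^sub>1 \<in> arcs_between G i\<^sub>1 i\<^sub>2 \<Longrightarrow> \<alpha>\<^sub>2 \<in> arcs_between G i\<^sub>3 i\<^sub>2 \<Longrightarrow>
        \<alpha>\<^sub>3 \<in> arcs_between G i\<^sub>3 i\<^sub>4 \<Longrightarrow> \<alpha>\<^sub>4 \<in> arcs_between G i\<^sub>1 i\<^sub>4 \<Longrightarrow>
        (\<Sum>(k, \<beta>\<^sub>1, \<beta>\<^sub>2, \<beta>\<^sub>3, \<beta>\<^sub>4) \<in> {(k, \<beta>\<^sub>1, \<beta>\<^sub>2, \<beta>\<^sub>3, \<beta>\<^sub>4).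
              \<beta>\<^sub>1 \<in> arcs_between G i\<^sub>2 k \<and> \<beta>\<^sub>2 \<in> arcs_between G k i\<^sub>1 \<and>
              \<beta>\<^sub>3 \<in> arcs_between G k i\<^sub>3 \<and> \<beta>\<^sub>4 \<in> arcs_between G i\<^sub>4 k}.
            inverse (\<phi> k) * W (\<alpha>\<^sub>1, \<beta>\<^sub>1, \<beta>\<^sub>2) * cnj (W (\<alpha>\<^sub>2, \<beta>\<^sub>1, \<beta>\<^sub>3)) *
              W (\<alpha>\<^sub>3, \<beta>\<^sub>4, \<beta>\<^sub>3) * cnj (W (\<alpha>\<^sub>4, \<beta>\<^sub>4, \<beta>\<^sub>2)))
          = of_bool (\<alpha>\<^sub>1 = \<alpha>\<^sub>4) * of_bool (\<alpha>\<^sub>2 = \<alpha>\<^sub>3) * \<phi> i\<^sub>1 * \<phi> i\<^sub>2 * \<phi> i\<^sub>3 +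
            of_bool (\<alpha>\<^sub>1 = \<alpha>\<^sub>2) * of_bool (\<alpha>\<^sub>3 = \<alpha>\<^sub>4) * \<phi> i\<^sub>1 * \<phi> i\<^sub>2 * \<phi> i\<^sub>4"

definition unitary_on :: "'b set \<Rightarrow> ('b \<Rightarrow> 'b \<Rightarrow> complex) \<Rightarrow> bool" where
  "unitary_on S u \<longleftrightarrow> (\<forall>\<sigma>\<in>S. \<forall>\<tau>\<in>S.
     (\<Sum>\<rho>\<in>S. u \<sigma> \<rho> * cnj (u \<tau> \<rho>)) = of_bool (\<sigma> = \<tau>) \<and>
     (\<Sum>\<rho>\<in>S. cnj (u \<rho> \<sigma>) * u \<rho> \<tau>) = of_bool (\<sigma> = \<tau>))"

text \<open>One function \<open>u\<close> carries the unitary matrices for all pairs of vertices, since an edge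
  determines its end points.\<close>

definition cell_equivalent ::
  "('a, 'b) pre_digraph \<Rightarrow> ('b \<times> 'b \<times> 'b \<Rightarrow> complex) \<Rightarrow> ('b \<times> 'b \<times> 'b \<Rightarrow> complex) \<Rightarrow> bool" where
  "cell_equivalent G W\<^sub>1 W\<^sub>2 \<longleftrightarrow> (\<exists>u.
     (\<forall>i\<in>verts G. \<forall>j\<in>verts G. unitary_on (arcs_between G i j) u) \<and>
     (\<forall>i j k \<sigma> \<rho> \<gamma>.
        \<sigma> \<in> arcs_between G i j \<longrightarrow> \<rho> \<in> arcs_between G j k \<longrightarrow> \<gamma> \<in> arcs_between G k i \<longrightarrow>
        W\<^sub>1 (\<sigma>, \<rho>, \<gamma>) =
          (\<Sum>\<sigma>'\<in>arcs_between G i j. \<Sum>\<rho>'\<in>arcs_between G j k. \<Sum>\<gamma>'\<in>arcs_between G k i.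
             u \<sigma> \<sigma>' * u \<rho> \<rho>' * u \<gamma> \<gamma>' * W\<^sub>2 (\<sigma>', \<rho>', \<gamma>'))))"

type_synonym vertex = "nat \<times> nat"
type_synonym edge = "vertex \<times> vertex"

definition A_inf :: "(vertex, edge) pre_digraph" where
  "A_inf = \<lparr> verts = UNIV,
     arcs = {((a, b), (a + 1, b)) | a b. True} \<union>
            {((a + 1, b), (a, b + 1)) | a b. True} \<union>
            {((a, b + 1), (a, b)) | a b. True},
     tail = fst, head = snd \<rparr>"

definition A_fin :: "nat \<Rightarrow> (vertex, edge) pre_digraph" where
  "A_fin n = A_inf \<restriction> {(a, b). a + b + 3 \<le> n}"

definition A_eigvec :: "complex \<Rightarrow> vertex \<Rightarrow> complex" where
  "A_eigvec q = (\<lambda>(a, b). qnum q (a + 1) * qnum q (b + 1) * qnum q (a + b + 2) / qnum q 2)"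

definition up_triangle :: "nat \<Rightarrow> nat \<Rightarrow> edge \<times> edge \<times> edge" where
  "up_triangle k m =
     (((k, m), (k + 1, m)), ((k + 1, m), (k, m + 1)), ((k, m + 1), (k, m)))"

definition down_triangle :: "nat \<Rightarrow> nat \<Rightarrow> edge \<times> edge \<times> edge" where
  "down_triangle k m =
     (((k + 1, m), (k, m + 1)), ((k, m + 1), (k + 1, m + 1)), ((k + 1, m + 1), (k + 1, m)))"

text \<open>The radicands are nonnegative reals wherever this is used, so that \<open>csqrt\<close> is the usual
  nonnegative square root. Every triangle of the graphs above is a rotation of an
  \<open>up_triangle\<close> or a \<open>down_triangle\<close>, so a rotation-invariant \<open>W\<close> is determined on all triangles.\<close>

definition given_by_formulas ::
  "(vertex, edge) pre_digraph \<Rightarrow> complex \<Rightarrow> (edge \<times> edge \<times> edge \<Rightarrow> complex) \<Rightarrow> bool" where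
  "given_by_formulas G q W \<longleftrightarrow> (\<forall>k m.
     (up_triangle k m \<in> triangles G \<longrightarrow> W (up_triangle k m) =
        csqrt (qnum q (k + 1) * qnum q (k + 2) * qnum q (m + 1) * qnum q (m + 2) *
               qnum q (k + m + 2) * qnum q (k + m + 3)) / qnum q 2) \<and>
     (down_triangle k m \<in> triangles G \<longrightarrow> W (down_triangle k m) =
        csqrt (qnum q (k + 1) * qnum q (k + 2) * qnum q (m + 1) * qnum q (m + 2) *
               qnum q (k + m + 3) * qnum q (k + m + 4)) / qnum q 2))"

end

theory Submission
  imports Defs
begin

text \<open>
The graphs have no multiple edges, and every triangle consists of one step each in the directions
\<open>(1, 0)\<close>, \<open>(-1, 1)\<close>, \<open>(0, -1)\<close>. An edge therefore lies on at most two triangles, and two distinct edges with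
a common source or target lie on exactly one common triangle. There are no four distinct edges
\<open>i1 \<rightarrow> i2 \<leftarrow> i3 \<rightarrow> i4 \<leftarrow> i1\<close> (lemma \<open>no_alternating_square\<close>), so both types of relations constrain
only the squared moduli of the cells.

Existence. With \<open>p1, p2\<close> the neighbours of a quantum number \<open>p\<close>, type I on an edge is the recursion
\<open>p1 + p2 = [2] p\<close>. Type II with all four edges equal is a three-term identity that comes from
\<open>[b + 1] [a + b] - [b] [a + b + 1] = [a]\<close> (lemma \<open>c_sub\<close>), and type II for two different edges is an equality of
monomials. Where a triangle is missing at a wall of the quadrant, its contribution contains the
factor \<open>[0]\<close>; where it is missing at the outer boundary of the finite graph, it contains \<open>[n]\<close>.
So the boundary needs no separate identities, and both graphs can be treated together.

Uniqueness. Type I fixes the moduli, by induction along the strip of triangles over each edge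
\<open>(k, 0) \<rightarrow> (k + 1, 0)\<close> (lemma \<open>cell_system_moduli\<close>). The remaining phases on triangles are products
of edge phases, which are found along the same strips (lemma \<open>cell_systems_equivalent\<close>).
\<close>

section \<open>Graphs cut off at a level\<close>

text \<open>Both \<open>A_inf\<close> and \<open>A_fin n\<close> keep the vertices \<open>(a, b)\<close> whose level \<open>a + b + 2\<close> lies in a downward closed
set of naturals. The shift by 2 makes the level the largest quantum number index occurring in the
eigenvector at \<open>(a, b)\<close>, and makes \<open>n\<close>, where \<open>[n] = 0\<close>, the first level outside \<open>A_fin n\<close>.\<close>

definition level_graph :: "(nat \<Rightarrow> bool) \<Rightarrow> (vertex, edge) pre_digraph" where
  "level_graph L = A_inf \<restriction> {(a, b). L (a + b + 2)}"

lemma verts_level_graph: "verts (level_graph L) = {(a, b). L (a + b + 2)}"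
  by (simp add: level_graph_def)

lemma tail_head_level_graph [simp]:
  "tail (level_graph L) = fst" "head (level_graph L) = snd"
  by (simp_all add: level_graph_def A_inf_def)

lemma arc_iff:
  "((a, b), (c, d)) \<in> arcs (level_graph L) \<longleftrightarrow>
     L (a + b + 2) \<and> L (c + d + 2) \<and>
     (c = a + 1 \<and> d = b \<or> a = c + 1 \<and> d = b + 1 \<or> a = c \<and> b = d + 1)"
  by (auto simp: level_graph_def A_inf_def)

lemma A_fin_eq: "A_fin n = level_graph (\<lambda>s. s < n)"
  by (auto simp: level_graph_def A_fin_def intro!: arg_cong[where f="induce_subgraph A_inf"])

lemma A_inf_eq: "A_inf = level_graph (\<lambda>s. True)"
  by (auto simp: level_graph_def A_inf_def induce_subgraph_def)

lemma arcs_between_eq: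
  "arcs_between (level_graph L) i j = (if (i, j) \<in> arcs (level_graph L) then {(i, j)} else {})"
  by (auto simp: arcs_between_def)

lemma in_arcs_between:
  "e \<in> arcs_between (level_graph L) i j \<longleftrightarrow> e = (i, j) \<and> (i, j) \<in> arcs (level_graph L)"
  by (auto simp: arcs_between_eq)

abbreviation tri :: "vertex \<Rightarrow> vertex \<Rightarrow> vertex \<Rightarrow> edge \<times> edge \<times> edge" where
  "tri i j k \<equiv> ((i, j), (j, k), (k, i))"

lemma in_triangles_iff:
  "t \<in> triangles (level_graph L) \<longleftrightarrow>
     (\<exists>i j k. t = tri i j k \<and> (i, j) \<in> arcs (level_graph L) \<and>
        (j, k) \<in> arcs (level_graph L) \<and> (k, i) \<in> arcs (level_graph L))"
  unfolding triangles_def by (cases t) (auto simp: in_arcs_between)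

text \<open>There are no multiple edges, so a triangle on the edge \<open>i \<rightarrow> j\<close> is the same as its third vertex.\<close>

definition apexes :: "(nat \<Rightarrow> bool) \<Rightarrow> vertex \<Rightarrow> vertex \<Rightarrow> vertex set" where
  "apexes L i j = {k. (j, k) \<in> arcs (level_graph L) \<and> (k, i) \<in> arcs (level_graph L)}"

lemma sum_over_apexes:
  "(\<Sum>(k, \<beta>, \<gamma>) \<in> {(k, \<beta>, \<gamma>). \<beta> \<in> arcs_between (level_graph L) j k \<and>
        \<gamma> \<in> arcs_between (level_graph L) k i}. F k \<beta> \<gamma>) =
   (\<Sum>k \<in> apexes L i j. F k (j, k) (k, i))"
  by (rule sum.reindex_bij_witness[where i="\<lambda>k. (k, (j, k), (k, i))" and j=fst])
     (auto simp: in_arcs_between apexes_def)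

lemma sum_over_common_apexes:
  "(\<Sum>(k, \<beta>1, \<beta>2, \<beta>3, \<beta>4) \<in> {(k, \<beta>1, \<beta>2, \<beta>3, \<beta>4).
        \<beta>1 \<in> arcs_between (level_graph L) i2 k \<and> \<beta>2 \<in> arcs_between (level_graph L) k i1 \<and>
        \<beta>3 \<in> arcs_between (level_graph L) k i3 \<and> \<beta>4 \<in> arcs_between (level_graph L) i4 k}.
        F k \<beta>1 \<beta>2 \<beta>3 \<beta>4) =
   (\<Sum>k \<in> apexes L i1 i2 \<inter> apexes L i3 i4. F k (i2, k) (k, i1) (k, i3) (i4, k))"
  by (rule sum.reindex_bij_witness
        [where i="\<lambda>k. (k, (i2, k), (k, i1), (k, i3), (i4, k))" and j=fst])
     (auto simp: in_arcs_between apexes_def)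

lemma up_triangle_eq: "up_triangle k m = tri (k, m) (k + 1, m) (k, m + 1)"
  by (simp add: up_triangle_def)

lemma down_triangle_eq: "down_triangle k m = tri (k + 1, m) (k, m + 1) (k + 1, m + 1)"
  by (simp add: down_triangle_def)

locale level_set =
  fixes L :: "nat \<Rightarrow> bool"
  assumes down: "L (Suc s) \<Longrightarrow> L s"
begin

abbreviation "G \<equiv> level_graph L"

lemma level_le:
  assumes "L t" and "s \<le> t"
  shows "L s"
  using assms(2,1) by (induction rule: inc_induct) (auto intro: down)

text \<open>Horizontal, diagonal and vertical edges each bound at most two triangles, one of either orientation.
At a wall of the quadrant, or at the cut-off level in the diagonal case, one of the two is missing.\<close>

lemma apexes_1: "L (a + b + 3) \<Longrightarrow>
  apexes L (a, b) (a + 1, b) = {(a, b + 1)} \<union> (if b = 0 then {} else {(a + 1, b - 1)})"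
  by (auto simp: apexes_def arc_iff numeral_eq_Suc dest: down split: if_splits)

lemma apexes_2: "L (a + b + 3) \<Longrightarrow>
  apexes L (a + 1, b) (a, b + 1) = {(a, b)} \<union> (if L (a + b + 4) then {(a + 1, b + 1)} else {})"
  by (auto simp: apexes_def arc_iff numeral_eq_Suc dest: down split: if_splits)

lemma apexes_3: "L (a + b + 3) \<Longrightarrow>
  apexes L (a, b + 1) (a, b) = {(a + 1, b)} \<union> (if a = 0 then {} else {(a - 1, b + 1)})"
  by (auto simp: apexes_def arc_iff numeral_eq_Suc dest: down split: if_splits)

lemma sum_apexes_1: "L (a + b + 3) \<Longrightarrow> 
  (\<Sum>k\<in>apexes L (a, b) (a + 1, b). F k) = F (a, b + 1) + (if b = 0 then 0 else F (a + 1, b - 1))"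
  by (subst apexes_1) auto

lemma sum_apexes_2: "L (a + b + 3) \<Longrightarrow>
  (\<Sum>k\<in>apexes L (a + 1, b) (a, b + 1). F k) = F (a, b) + (if L (a + b + 4) then F (a + 1, b + 1) else 0)"
  by (subst apexes_2) auto

lemma sum_apexes_3: "L (a + b + 3) \<Longrightarrow>
  (\<Sum>k\<in>apexes L (a, b + 1) (a, b). F k) = F (a + 1, b) + (if a = 0 then 0 else F (a - 1, b + 1))"
  by (subst apexes_3) auto

lemma arc_cases:
  assumes "(i, j) \<in> arcs G"
  obtains a b where "L (a + b + 3)" "i = (a, b)" "j = (a + 1, b)"
    | a b where "L (a + b + 3)" "i = (a + 1, b)" "j = (a, b + 1)"
    | a b where "L (a + b + 3)" "i = (a, b + 1)" "j = (a, b)"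
  using assms by (cases i; cases j) (auto simp: arc_iff numeral_eq_Suc)

lemma triangle_cases:
  assumes "t \<in> triangles G"
  obtains k m i j l where "L (k + m + 3)" "up_triangle k m = tri i j l"
      "t = tri i j l \<or> t = tri j l i \<or> t = tri l i j"
    | k m i j l where "L (k + m + 4)" "down_triangle k m = tri i j l"
      "t = tri i j l \<or> t = tri j l i \<or> t = tri l i j"
proof -
  from assms obtain i j l where t: "t = tri i j l" and ij: "(i, j) \<in> arcs G"
    and "(j, l) \<in> arcs G" "(l, i) \<in> arcs G" unfolding in_triangles_iff by blast
  hence l: "l \<in> apexes L i j" by (simp add: apexes_def)
  from ij show thesis
  proof (cases rule: arc_cases)
    case (1 a b)
    with l consider "l = (a, b + 1)" | b' where "b = b' + 1" "l = (a + 1, b')"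
      unfolding 1(2,3) apexes_1[OF 1(1)] by (cases b) (auto split: if_splits)
    thus thesis
      using that(1)[of a b i j l] that(2)[of a "b-1" l i j] t 1
      by cases (auto simp: up_triangle_def down_triangle_def numeral_eq_Suc)
  next
    case (2 a b)
    with l consider "l = (a, b)" | "l = (a + 1, b + 1)" "L (a + b + 4)"
      unfolding 2(2,3) apexes_2[OF 2(1)] by (auto split: if_splits)
    thus thesis
      using that(1)[of a b l i j] that(2)[of a b i j l] t 2
      by cases (auto simp: up_triangle_def down_triangle_def numeral_eq_Suc)
  next
    case (3 a b)
    with l consider "l = (a + 1, b)" | a' where "a = a' + 1" "l = (a', b + 1)"
      unfolding 3(2,3) apexes_3[OF 3(1)] by (cases a) (auto split: if_splits)
    thus thesis
      using that(1)[of a b j l i] that(2)[of "a-1" b j l i] t 3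
      by cases (auto simp: up_triangle_def down_triangle_def numeral_eq_Suc)
  qed
qed

lemma up_in_triangles: "up_triangle k m \<in> triangles G \<longleftrightarrow> L (k + m + 3)"
  by (auto simp: in_triangles_iff up_triangle_def arc_iff numeral_eq_Suc dest: down)

lemma down_in_triangles: "down_triangle k m \<in> triangles G \<longleftrightarrow> L (k + m + 4)"
  by (auto simp: in_triangles_iff down_triangle_def arc_iff numeral_eq_Suc dest: down)

lemma wf: "wf_digraph G"
  unfolding wf_digraph_def
  by (auto simp: verts_level_graph arc_iff)

lemma out_arcs_eq:
  assumes "L (a + b + 2)"
  shows "out_arcs G (a, b) = (\<lambda>j. ((a, b), j)) `
   ((if L (a + b + 3) then {(a + 1, b)} else {}) \<union> (if a = 0 then {} else {(a - 1, b + 1)}) \<union>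
    (if b = 0 then {} else {(a, b - 1)}))" (is "_ = _ ` ?N")
proof -
  have "((a, b), j) \<in> arcs G \<longleftrightarrow> j \<in> ?N" for j
    using assms level_le[OF assms, of "a + b + 1"]
    by (cases j; cases a; cases b) (auto simp: arc_iff numeral_eq_Suc intro!: gr0I)
  hence "?N = {j. ((a, b), j) \<in> arcs G}" by blast
  thus ?thesis by (auto simp: out_arcs_def)
qed

lemma sum_out_arcs: "(\<Sum>e\<in>out_arcs G (a, b). (\<psi> :: _ \<Rightarrow> 'c :: comm_monoid_add) (head G e)) =
    (if L (a + b + 3) then \<psi> (a + 1, b) else 0) + (if a = 0 then 0 else \<psi> (a - 1, b + 1)) +
    (if b = 0 then 0 else \<psi> (a, b - 1))" if "L (a + b + 2)"
  by (subst out_arcs_eq[OF that]) (auto simp: inj_on_def ac_simps)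

lemma finite_arcs_at: "finite (out_arcs G i) \<and> finite (in_arcs G i)" 
proof -
  obtain a b where i: "i = (a, b)" by fastforce
  have "out_arcs G i \<subseteq> (\<lambda>j. (i, j)) ` ({..a + 1} \<times> {..b + 1})"
    by (auto simp: i out_arcs_def arc_iff)
  moreover have "in_arcs G i \<subseteq> (\<lambda>j. (j, i)) ` ({..a + 1} \<times> {..b + 1})"
    by (auto simp: i in_arcs_def arc_iff)
  ultimately show ?thesis by (auto elim!: finite_subset)
qed

text \<open>The three steps \<open>(1, 0)\<close>, \<open>(-1, 1)\<close>, \<open>(0, -1)\<close> have pairwise distinct differences. Hence \<open>i2 - i4\<close>
determines the steps from \<open>i1\<close> and from \<open>i3\<close> as soon as it is nonzero. So the type II relation never
compares phases of different cells: each of its terms is a product of squared moduli.\<close>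

lemma no_alternating_square:
  assumes "(i1, i2) \<in> arcs G" "(i3, i2) \<in> arcs G" "(i3, i4) \<in> arcs G" "(i1, i4) \<in> arcs G"
  shows "i1 = i3 \<or> i2 = i4"
  using assms by (cases i1; cases i2; cases i3; cases i4) (auto simp: arc_iff)

end


section \<open>Recursion for quantum numbers and positive eigenvectors\<close>

lemma qnum_0: "qnum q 0 = 0"
  by (simp add: qnum_def)

lemma inverse_ne_self:
  fixes q :: complex
  assumes "q \<noteq> 0" "q \<noteq> 1" "q \<noteq> - 1"
  shows "q - inverse q \<noteq> 0"
proof
  assume "q - inverse q = 0"
  hence "(q - 1) * (q + 1) = 0" using assms(1) by (simp add: field_simps)
  thus False using assms by (simp add: eq_neg_iff_add_eq_0)
qed

lemma qnum_1: "q \<noteq> 0 \<Longrightarrow> q \<noteq> - 1 \<Longrightarrow> qnum q 1 = 1"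
  using inverse_ne_self[of q] by (simp add: qnum_def)

lemma qnum_2: "q \<noteq> 0 \<Longrightarrow> q \<noteq> - 1 \<Longrightarrow> qnum q 2 = q + inverse q"
proof (cases "q = 1")
  case False
  assume q: "q \<noteq> 0" "q \<noteq> - 1"
  have "q ^ 2 - inverse q ^ 2 = (q + inverse q) * (q - inverse q)"
    by (simp add: power2_eq_square algebra_simps)
  thus ?thesis using False inverse_ne_self[OF q(1) False q(2)] by (simp add: qnum_def)
qed (simp add: qnum_def)

text \<open>Every identity between quantum numbers used below follows from this recursion with \<open>[0] = 0\<close> and \<open>[1] = 1\<close>. It holds in the
same form for the root of unity, for real \<open>q\<close> and for the degenerate value \<open>q = 1\<close>.\<close>

lemma qnum_rec:
  assumes "q \<noteq> 0" "q \<noteq> - 1"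
  shows "qnum q (m + 2) = qnum q 2 * qnum q (m + 1) - qnum q m"
proof (cases "q = 1")
  case False
  have cancel: "q * (inverse q * z) = z" for z using assms(1) by simp
  have "q ^ (m + 2) - inverse q ^ (m + 2) =
     (q + inverse q) * (q ^ (m + 1) - inverse q ^ (m + 1)) - (q ^ m - inverse q ^ m)"
    by (simp add: algebra_simps cancel del: power_inverse)
  thus ?thesis
    by (simp only: qnum_2[OF assms] qnum_def[of q "m + 2"] qnum_def[of q "m + 1"]
        qnum_def[of q m] False if_False times_divide_eq_right
        flip: diff_divide_distrib)
qed (simp add: qnum_def algebra_simps)

text \<open>Compare \<open>|\<psi>|\<close> with the positive eigenvector \<open>f\<close> at a vertex where \<open>|\<psi>| / f\<close> is largest: there the
eigenvalue equation for \<open>\<psi>\<close> and the triangle inequality bound \<open>|\<mu>|\<close> by the eigenvalue of \<open>f\<close>.\<close>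

lemma positive_eigenvector_dominates:
  assumes fin: "finite (verts G)" and wf: "wf_digraph G"
    and "\<And>i. i \<in> verts G \<Longrightarrow> 0 < f i"
    and "\<And>i. i \<in> verts G \<Longrightarrow> (\<Sum>e\<in>out_arcs G i. f (head G e)) = (r :: real) * f i"
    and eig: "adj_eigen G \<mu> \<psi>"
  shows "cmod \<mu> \<le> r"
proof -
  define R where "R = (\<lambda>i. cmod (\<psi> i) / f i)"
  from eig obtain v where v: "v \<in> verts G" "\<psi> v \<noteq> 0" unfolding adj_eigen_def by blast
  have "Max (R ` verts G) \<in> R ` verts G" using fin v by (intro Max_in) auto
  then obtain u where u: "u \<in> verts G" and Ru: "R u = Max (R ` verts G)" by force
  have max: "R i \<le> R u" if "i \<in> verts G" for i
    unfolding Ru using fin that by (intro Max_ge) auto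
  have "0 < R v" using v assms(3) by (simp add: R_def)
  with max[OF v(1)] have Ru0: "0 < R u" by linarith
  have bound: "cmod (\<psi> i) \<le> R u * f i" if "i \<in> verts G" for i
    using max[OF that] assms(3)[OF that] by (simp add: R_def field_simps)
  have "cmod \<mu> * (R u * f u) = cmod (\<mu> * \<psi> u)"
    using assms(3)[OF u] by (simp add: R_def norm_mult)
  also have "\<dots> = cmod (\<Sum>e\<in>out_arcs G u. \<psi> (head G e))"
    using eig u unfolding adj_eigen_def by simp
  also have "\<dots> \<le> (\<Sum>e\<in>out_arcs G u. R u * f (head G e))"
    by (rule sum_norm_le) (use wf bound in \<open>auto simp: wf_digraph_def\<close>)
  also have "\<dots> = r * (R u * f u)"
    using assms(4)[OF u] by (simp flip: sum_distrib_left)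
  finally show ?thesis using Ru0 assms(3)[OF u] by simp
qed

text \<open>The difference of the two sides is \<open>x' (p1 y - p y') - x (p y - p2 y')\<close>, which the assumptions turn
into \<open>x' x - x x'\<close>.\<close>

lemma three_term_swap:
  fixes x y x' y' p p1 p2 :: real
  assumes "p1 * y - p * y' = x" and "p * y - p2 * y' = x'"
  shows "p1 * x' * y + p2 * x * y' = p * (x * y + x' * y')"
  unfolding assms[symmetric] by (simp only: algebra_simps)

section \<open>The cells and their type I and type II sums\<close>

text \<open>On the vertices of a triangle the coordinates \<open>a + 1\<close>, \<open>b + 1\<close> and \<open>a + b + 2\<close> each take two consecutive
values, and the squared cell is the product of all six quantum numbers divided by \<open>[2]\<^sup>2\<close>. Writing
it with minima covers both orientations of triangles at once and makes it symmetric under rotation.\<close>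

definition cell_square :: "(nat \<Rightarrow> real) \<Rightarrow> vertex \<Rightarrow> vertex \<Rightarrow> vertex \<Rightarrow> real" where
  "cell_square c i j k =
     (let f = (\<lambda>s. c s * c (s + 1)); x = min (fst i) (min (fst j) (fst k));
          y = min (snd i) (min (snd j) (snd k));
          z = min (fst i + snd i) (min (fst j + snd j) (fst k + snd k))
      in f (x + 1) * f (y + 1) * f (z + 2) / (c 2)\<^sup>2)"

definition cell :: "(nat \<Rightarrow> real) \<Rightarrow> edge \<times> edge \<times> edge \<Rightarrow> complex" where
  "cell c = (\<lambda>(\<alpha>, \<beta>, \<gamma>). of_real (sqrt (cell_square c (fst \<alpha>) (fst \<beta>) (fst \<gamma>))))"

lemma cell_square_rotate: "cell_square c j k i = cell_square c i j k"
  by (simp add: cell_square_def min.commute min.left_commute)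

text \<open>The assumptions common to both parts: \<open>c\<close> gives the real values of the quantum numbers, which are
positive on the levels of the graph and vanish at the first level outside it.\<close>

locale quantum_level_set = level_set +
  fixes q :: complex and c :: "nat \<Rightarrow> real"
  assumes L2: "L 2" and q_ne: "q \<noteq> 0" "q \<noteq> - 1"
    and qnum_real: "qnum q m = of_real (c m)"
    and c_pos: "L s \<Longrightarrow> 0 < s \<Longrightarrow> 0 < c s"
    and c_boundary: "L s \<Longrightarrow> \<not> L (Suc s) \<Longrightarrow> c (Suc s) = 0"
begin

lemma c_0: "c 0 = 0" and c_1: "c (Suc 0) = 1"
  using qnum_real[of 0] qnum_real[of 1] qnum_1[OF q_ne] by (simp_all add: qnum_0)

lemma c_rec: "c (m + 2) = c 2 * c (m + 1) - c m"
  using qnum_rec[OF q_ne, of m] unfolding qnum_real by (metis of_real_eq_iff of_real_diff of_real_mult)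

lemma c_add: "c (a + b + 1) = c (a + 1) * c (b + 1) - c a * c b"
proof (induction b rule: induct_nat_012)
  case 1
  show ?case using c_rec[of a] by (simp add: c_0 c_1 numeral_2_eq_2 algebra_simps)
next
  case (ge2 b)
  have "c (a + Suc (Suc b) + 1) = c 2 * c (a + Suc b + 1) - c (a + b + 1)"
    using c_rec[of "a + b + 1"] by simp
  also have "\<dots> = c (a + 1) * (c 2 * c (Suc b + 1) - c (b + 1)) - c a * (c 2 * c (Suc b) - c b)"
    unfolding ge2 by (simp only: algebra_simps)
  also have "\<dots> = c (a + 1) * c (Suc (Suc b) + 1) - c a * c (Suc (Suc b))"
    using c_rec[of b] c_rec[of "b + 1"] by simp
  finally show ?case .
qed (simp_all add: c_0 c_1)

lemma c_sub: "c (b + 1) * c (a + b) - c b * c (a + b + 1) = c a"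
proof (induction b)
  case (Suc b)
  have "c (Suc b + 1) * c (a + Suc b) - c (Suc b) * c (a + Suc b + 1) =
      (c 2 * c (b + 1) - c b) * c (a + b + 1) - c (b + 1) * (c 2 * c (a + b + 1) - c (a + b))"
    using c_rec[of b] c_rec[of "a + b"] by simp
  also have "\<dots> = c (b + 1) * c (a + b) - c b * c (a + b + 1)"
    by (simp only: algebra_simps)
  finally have "c (Suc b + 1) * c (a + Suc b) - c (Suc b) * c (a + Suc b + 1) =
      c (b + 1) * c (a + b) - c b * c (a + b + 1)" .
  with Suc show ?case by simp
qed (simp add: c_0 c_1)

definition pf_vec :: "vertex \<Rightarrow> real" where
  "pf_vec = (\<lambda>(a, b). c (a + 1) * c (b + 1) * c (a + b + 2) / c 2)"

lemma A_eigvec_eq: "A_eigvec q i = of_real (pf_vec i)"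
  by (cases i) (simp add: A_eigvec_def pf_vec_def qnum_real)

lemma c2_pos: "0 < c 2" using c_pos[OF L2] by simp

lemma pf_vec_pos: "i \<in> verts G \<Longrightarrow> 0 < pf_vec i"
  using level_le[of "fst i + snd i + 2" "fst i + 1"] level_le[of "fst i + snd i + 2" "snd i + 1"]
  by (cases i) (auto simp: pf_vec_def verts_level_graph intro!: divide_pos_pos mult_pos_pos c_pos c2_pos)

lemma cell_square_nonneg:
  assumes "i \<in> verts G"
  shows "0 \<le> cell_square c i j k"
proof -
  have f: "0 \<le> c (s + 1) * c (s + 1 + 1)" if "s + 1 \<le> fst i + snd i + 2" for s
  proof -
    have s: "L (s + 1)" using assms level_le[OF _ that] by (auto simp: verts_level_graph)
    show ?thesis using c_pos[OF s] c_pos[of "s + 2"] c_boundary[OF s]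
      by (cases "L (s + 2)") auto
  qed
  define x y z where "x = min (fst i) (min (fst j) (fst k))"
    and "y = min (snd i) (min (snd j) (snd k))"
    and "z = min (fst i + snd i) (min (fst j + snd j) (fst k + snd k))"
  note defs = this
  have "x \<le> fst i" "y \<le> snd i" "z \<le> fst i + snd i" by (simp_all add: defs)
  thus ?thesis unfolding cell_square_def Let_def defs[symmetric]
    using mult_nonneg_nonneg[OF mult_nonneg_nonneg[OF f[of x] f[of y]] f[of "z + 1"]]
    by (intro divide_nonneg_nonneg) simp_all
qed

lemma cell_square_up:
  "cell_square c (a, b) (a + 1, b) (a, b + 1) =
     c (a + 1) * c (a + 2) * c (b + 1) * c (b + 2) * c (a + b + 2) * c (a + b + 3) / (c 2)\<^sup>2"
  by (simp add: cell_square_def numeral_eq_Suc)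

lemma cell_square_down:
  "cell_square c (a + 1, b) (a, b + 1) (a + 1, b + 1) =
     c (a + 1) * c (a + 2) * c (b + 1) * c (b + 2) * c (a + b + 3) * c (a + b + 4) / (c 2)\<^sup>2"
  by (simp add: cell_square_def numeral_eq_Suc)

text \<open>By the addition formula, with \<open>x, y\<close> the values at \<open>a + 1, b + 1\<close> and \<open>x', y'\<close> the preceding ones, the
eigenvalue equation is a polynomial identity. Neighbours missing at the walls or at the cut-off
may be included in the sum, since the formula for the eigenvector gives them the value 0.\<close>

lemma pf_vec_eigen:
  assumes "i \<in> verts G"
  shows "(\<Sum>e\<in>out_arcs G i. pf_vec (head G e)) = c 3 * pf_vec i"
proof -
  obtain a b where i: "i = (a, b)" by fastforce
  with assms have L: "L (a + b + 2)" by (simp add: verts_level_graph)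
  define x y x' y' C D where "x = c (a + 1)" "y = c (b + 1)" "x' = c a" "y' = c b"
    and "C = c (a + b + 2)" and "D = c (a + b + 1)"
  note defs = this
  have D: "D = x * y - x' * y'" using c_add[of a b] by (simp add: defs)
  have y2: "c (b + 2) = c 2 * y - y'" using c_rec[of b] by (simp add: defs)
  have x2: "c (a + 2) = c 2 * x - x'" using c_rec[of a] by (simp add: defs)
  have C: "C = x * (c 2 * y - y') - x' * y"
    using c_add[of a "b + 1"] y2 by (simp add: defs)
  have C2: "c (a + b + 3) = c 2 * C - D" 
    using c_rec[of "a + b + 1"] by (simp add: defs numeral_eq_Suc)
  have c3: "c 3 = (c 2)\<^sup>2 - 1"
    using c_rec[of 1] by (simp add: c_1 power2_eq_square numeral_eq_Suc)
  have 1: "(if L (a + b + 3) then pf_vec (a + 1, b) else 0) = (c 2 * x - x') * y * (c 2 * C - D) / c 2"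
  proof (cases "L (a + b + 3)")
    case False
    hence "c (a + b + 3) = 0" using c_boundary[OF L] by (simp add: numeral_eq_Suc)
    thus ?thesis using False C2 by simp
  next
    case True
    thus ?thesis unfolding C2[symmetric] x2[symmetric] by (simp add: pf_vec_def defs numeral_eq_Suc)
  qed
  have 2: "(if a = 0 then 0 else pf_vec (a - 1, b + 1)) = x' * (c 2 * y - y') * C / c 2"
    unfolding y2[symmetric] by (cases a) (simp_all add: pf_vec_def defs c_0 numeral_eq_Suc)
  have 3: "(if b = 0 then 0 else pf_vec (a, b - 1)) = x * y' * D / c 2"
    by (cases b) (simp_all add: pf_vec_def defs c_0 numeral_eq_Suc)
  have 4: "pf_vec (a, b) = x * y * C / c 2"
    by (simp add: pf_vec_def defs)
  have "(c 2 * x - x') * y * (c 2 * C - D) + x' * (c 2 * y - y') * C + x * y' * D = c 3 * (x * y * C)"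
    unfolding c3 D C by algebra
  thus ?thesis unfolding i sum_out_arcs[OF L] 1 2 3 4 
    by (simp flip: add_divide_distrib)
qed

text \<open>A common parametrisation of the three kinds of edges. Of the three coordinates \<open>a + 1\<close>, \<open>b + 1\<close>,
\<open>a + b + 2\<close>, an edge leaves one unchanged, with quantum number \<open>p\<close>; the other two
have values \<open>x, y\<close> at the source and \<open>x', y'\<close> at the target. The apexes of the two triangles on the edge have
\<open>p1\<close> and \<open>p2\<close>, the neighbours of \<open>p\<close>, in place of \<open>p\<close>. If an apex is missing then its \<open>p1\<close> or \<open>p2\<close>
is 0, which is why \<open>F 0 0 = 0\<close> suffices to sum over both.\<close>

lemma apex_sum:
  assumes "(i, j) \<in> arcs G"
  obtains x x' y y' p p1 p2 where
    "pf_vec i = x * p * y / c 2" "pf_vec j = x' * p * y' / c 2"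
    "p1 + p2 = c 2 * p" "p1 * x' * y + p2 * x * y' = p * (x * y + x' * y')"
    "\<forall>F :: real \<Rightarrow> real \<Rightarrow> real. F 0 0 = 0 \<longrightarrow>
      (\<Sum>k\<in>apexes L i j. F (cell_square c i j k) (pf_vec k)) =
        F (p * p1 * x * x' * y * y' / (c 2)\<^sup>2) (x * p1 * y' / c 2) +
        F (p * p2 * x * x' * y * y' / (c 2)\<^sup>2) (x' * p2 * y / c 2)"
  using assms
proof (cases rule: arc_cases)
  case (1 a b)
  show thesis
  proof (rule that)
    show "pf_vec i = c (a + 1) * c (b + 1) * c (a + b + 2) / c 2"
      and "pf_vec j = c (a + 2) * c (b + 1) * c (a + b + 3) / c 2"
      by (simp_all add: 1 pf_vec_def numeral_eq_Suc)
    show "c (b + 2) + c b = c 2 * c (b + 1)" using c_rec[of b] by simp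
    have "c (b + 2) * c (a + b + 2) - c (b + 1) * c (a + b + 3) = c (a + 1)"
      and "c (b + 1) * c (a + b + 2) - c b * c (a + b + 3) = c (a + 2)"
      using c_sub[of "b + 1" "a + 1"] c_sub[of b "a + 2"] by (simp_all add: numeral_eq_Suc)
    thus "c (b + 2) * c (a + 2) * c (a + b + 2) + c b * c (a + 1) * c (a + b + 3) =
        c (b + 1) * (c (a + 1) * c (a + b + 2) + c (a + 2) * c (a + b + 3))"
      by (rule three_term_swap)
    show "\<forall>F :: real \<Rightarrow> real \<Rightarrow> real. F 0 0 = 0 \<longrightarrow>
      (\<Sum>k\<in>apexes L i j. F (cell_square c i j k) (pf_vec k)) =
        F (c (b + 1) * c (b + 2) * c (a + 1) * c (a + 2) * c (a + b + 2) * c (a + b + 3) / (c 2)\<^sup>2)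
          (c (a + 1) * c (b + 2) * c (a + b + 3) / c 2) +
        F (c (b + 1) * c b * c (a + 1) * c (a + 2) * c (a + b + 2) * c (a + b + 3) / (c 2)\<^sup>2)
          (c (a + 2) * c b * c (a + b + 2) / c 2)"
      unfolding 1 sum_apexes_1[OF 1(1)]
      by (cases b) (simp_all add: cell_square_def pf_vec_def c_0 numeral_eq_Suc mult_ac)
  qed
next
  case (2 a b)
  show thesis
  proof (rule that)
    show "pf_vec i = c (a + 2) * c (a + b + 3) * c (b + 1) / c 2"
      and "pf_vec j = c (a + 1) * c (a + b + 3) * c (b + 2) / c 2"
      by (simp_all add: 2 pf_vec_def numeral_eq_Suc)
    show "c (a + b + 4) + c (a + b + 2) = c 2 * c (a + b + 3)"
      using c_rec[of "a + b + 2"] by (simp add: numeral_eq_Suc)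
    have "c (b + 2) * c (a + b + 2) - c (b + 1) * c (a + b + 3) = c (a + 1)"
      and "c (b + 2) * c (a + b + 3) - c (b + 1) * c (a + b + 4) = c (a + 2)"
      using c_sub[of "b + 1" "a + 1"] c_sub[of "b + 1" "a + 2"] by (simp_all add: numeral_eq_Suc)
    thus "c (a + b + 4) * c (a + 1) * c (b + 1) + c (a + b + 2) * c (a + 2) * c (b + 2) =
        c (a + b + 3) * (c (a + 2) * c (b + 1) + c (a + 1) * c (b + 2))"
      using three_term_swap[of "c (a + b + 4)" "- c (b + 1)" "c (a + b + 3)" "- c (b + 2)" "c (a + 2)"
          "c (a + b + 2)" "c (a + 1)"] by (simp add: algebra_simps)
    have bd: "c (Suc (Suc (Suc (Suc (a + b))))) = 0" if "\<not> L (a + b + 4)"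
      using c_boundary[OF 2(1)] that by (simp add: numeral_eq_Suc)
    show "\<forall>F :: real \<Rightarrow> real \<Rightarrow> real. F 0 0 = 0 \<longrightarrow>
      (\<Sum>k\<in>apexes L i j. F (cell_square c i j k) (pf_vec k)) =
        F (c (a + b + 3) * c (a + b + 4) * c (a + 2) * c (a + 1) * c (b + 1) * c (b + 2) / (c 2)\<^sup>2)
          (c (a + 2) * c (a + b + 4) * c (b + 2) / c 2) +
        F (c (a + b + 3) * c (a + b + 2) * c (a + 2) * c (a + 1) * c (b + 1) * c (b + 2) / (c 2)\<^sup>2)
          (c (a + 1) * c (a + b + 2) * c (b + 1) / c 2)"
      unfolding 2 sum_apexes_2[OF 2(1)] using bd
      by (cases "L (a + b + 4)") (simp_all add: cell_square_def pf_vec_def numeral_eq_Suc mult_ac)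
  qed
next
  case (3 a b)
  show thesis
  proof (rule that)
    show "pf_vec i = c (a + b + 3) * c (a + 1) * c (b + 2) / c 2"
      and "pf_vec j = c (a + b + 2) * c (a + 1) * c (b + 1) / c 2"
      by (simp_all add: 3 pf_vec_def numeral_eq_Suc)
    show "c (a + 2) + c a = c 2 * c (a + 1)" using c_rec[of a] by simp
    have "c (a + 2) * c (a + b + 2) - c (a + 1) * c (a + b + 3) = c (b + 1)"
      and "c (a + 1) * c (a + b + 2) - c a * c (a + b + 3) = c (b + 2)"
      using c_sub[of "a + 1" "b + 1"] c_sub[of a "b + 2"] by (simp_all add: numeral_eq_Suc add_ac)
    thus "c (a + 2) * c (a + b + 2) * c (b + 2) + c a * c (a + b + 3) * c (b + 1) =
        c (a + 1) * (c (a + b + 3) * c (b + 2) + c (a + b + 2) * c (b + 1))"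
      using three_term_swap[of "c (a + 2)" "c (a + b + 2)" "c (a + 1)" "c (a + b + 3)" "c (b + 1)"
          "c a" "c (b + 2)"] by (simp only: mult_ac add_ac)
    show "\<forall>F :: real \<Rightarrow> real \<Rightarrow> real. F 0 0 = 0 \<longrightarrow>
      (\<Sum>k\<in>apexes L i j. F (cell_square c i j k) (pf_vec k)) =
        F (c (a + 1) * c (a + 2) * c (a + b + 3) * c (a + b + 2) * c (b + 2) * c (b + 1) / (c 2)\<^sup>2)
          (c (a + b + 3) * c (a + 2) * c (b + 1) / c 2) +
        F (c (a + 1) * c a * c (a + b + 3) * c (a + b + 2) * c (b + 2) * c (b + 1) / (c 2)\<^sup>2)
          (c (a + b + 2) * c a * c (b + 2) / c 2)"
      unfolding 3 sum_apexes_3[OF 3(1)]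
      by (cases a) (simp_all add: cell_square_def pf_vec_def c_0 numeral_eq_Suc mult_ac)
  qed
qed

lemma cell_square_sum:
  assumes "(i, j) \<in> arcs G"
  shows "(\<Sum>k\<in>apexes L i j. cell_square c i j k) = c 2 * pf_vec i * pf_vec j"
proof -
  obtain x x' y y' p p1 p2 where
    e: "pf_vec i = x * p * y / c 2" "pf_vec j = x' * p * y' / c 2" "p1 + p2 = c 2 * p"
    and id: "p1 * x' * y + p2 * x * y' = p * (x * y + x' * y')"
    and sum: "\<forall>F :: real \<Rightarrow> real \<Rightarrow> real. F 0 0 = 0 \<longrightarrow>
      (\<Sum>k\<in>apexes L i j. F (cell_square c i j k) (pf_vec k)) =
        F (p * p1 * x * x' * y * y' / (c 2)\<^sup>2) (x * p1 * y' / c 2) +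
        F (p * p2 * x * x' * y * y' / (c 2)\<^sup>2) (x' * p2 * y / c 2)"
    by (rule apex_sum[OF assms])
  have "(\<Sum>k\<in>apexes L i j. cell_square c i j k) = (p1 + p2) * (p * x * x' * y * y') / (c 2)\<^sup>2"
    using sum[rule_format, of "\<lambda>s _. s"] by (simp add: algebra_simps add_divide_distrib)
  thus ?thesis using c2_pos unfolding e by (simp add: power2_eq_square)
qed

lemma cell_fourth_sum:
  assumes "(i, j) \<in> arcs G"
  shows "(\<Sum>k\<in>apexes L i j. (cell_square c i j k)\<^sup>2 / pf_vec k) =
    pf_vec i * pf_vec j * (pf_vec i + pf_vec j)"
proof -
  obtain x x' y y' p p1 p2 where
    e: "pf_vec i = x * p * y / c 2" "pf_vec j = x' * p * y' / c 2" "p1 + p2 = c 2 * p"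
    and id: "p1 * x' * y + p2 * x * y' = p * (x * y + x' * y')"
    and sum: "\<forall>F :: real \<Rightarrow> real \<Rightarrow> real. F 0 0 = 0 \<longrightarrow>
      (\<Sum>k\<in>apexes L i j. F (cell_square c i j k) (pf_vec k)) =
        F (p * p1 * x * x' * y * y' / (c 2)\<^sup>2) (x * p1 * y' / c 2) +
        F (p * p2 * x * x' * y * y' / (c 2)\<^sup>2) (x' * p2 * y / c 2)"
    by (rule apex_sum[OF assms])
  \<comment> \<open>This includes \<open>s = 0\<close>, the case of a missing apex, because \<open>0 / 0 = 0\<close>.\<close>
  have cancel: "(s * w / t\<^sup>2)\<^sup>2 / (s / t) = s * w\<^sup>2 / t ^ 3" for s w t :: real
    by (cases "s = 0"; cases "t = 0") (simp_all add: field_simps power2_eq_square power3_eq_cube)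
  have "(\<Sum>k\<in>apexes L i j. (cell_square c i j k)\<^sup>2 / pf_vec k) =
     (x * p1 * y') * (p * x' * y)\<^sup>2 / c 2 ^ 3 + (x' * p2 * y) * (p * x * y')\<^sup>2 / c 2 ^ 3"
    using sum[rule_format, of "\<lambda>s f. s\<^sup>2 / f"] cancel[of "x * p1 * y'" "p * x' * y" "c 2"]
      cancel[of "x' * p2 * y" "p * x * y'" "c 2"] by (simp add: mult_ac)
  also have "\<dots> = p\<^sup>2 * x * x' * y * y' * (p1 * x' * y + p2 * x * y') / c 2 ^ 3"
    by (simp add: power2_eq_square algebra_simps flip: add_divide_distrib)
  also have "\<dots> = pf_vec i * pf_vec j * (pf_vec i + pf_vec j)"
    using c2_pos unfolding e id by (simp add: field_simps power2_eq_square power3_eq_cube)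
  finally show ?thesis .
qed

lemma cell_tri: "cell c (tri i j k) = of_real (sqrt (cell_square c i j k))"
  by (simp add: cell_def)

text \<open>Two edges with a common source use two of the three steps, so a triangle on both has to return by
the remaining step, which determines its third vertex. With a single apex the type II relation is an
identity between monomials in quantum numbers.\<close>

lemma common_source:
  assumes "(i, j) \<in> arcs G" "(i, l) \<in> arcs G" "j \<noteq> l"
  obtains k where "apexes L i j \<inter> apexes L i l = {k}" "k \<in> verts G"
    "cell_square c i j k * cell_square c i l k = pf_vec k * (pf_vec i * pf_vec j * pf_vec l)"
proof -
  have "\<exists>k. apexes L i j \<inter> apexes L i l = {k} \<and> k \<in> verts G \<and> 
    cell_square c i j k * cell_square c i l k = pf_vec k * (pf_vec i * pf_vec j * pf_vec l)"
    if "(i, j) \<in> arcs G" "(i, l) \<in> arcs G" "fst l \<le> fst j" "j \<noteq> l" for j l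
    using that(1)
  proof (cases rule: arc_cases)
    case (1 a b)
    from that(2) show ?thesis
    proof (cases rule: arc_cases)
      case (2 a' b')
      show ?thesis using 1 2 c2_pos
        by (intro exI[of _ "(a, b + 1)"])
          (auto simp: apexes_def arc_iff verts_level_graph numeral_eq_Suc cell_square_def pf_vec_def
            divide_simps intro: down)
    next
      case (3 a' b')
      show ?thesis using 1 3 c2_pos
        by (intro exI[of _ "(a + 1, b')"])
          (auto simp: apexes_def arc_iff verts_level_graph numeral_eq_Suc cell_square_def pf_vec_def
            divide_simps intro: down)
    qed (use 1 that in auto)
  next
    case (2 a b)
    from that(2) show ?thesis
      by (cases rule: arc_cases) (use 2 that in auto)
  next
    case (3 a b)
    from that(2) show ?thesis
    proof (cases rule: arc_cases)
      case (2 a' b')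
      show ?thesis using 3 2 c2_pos
        by (intro exI[of _ "(a', b + 1)"])
          (auto simp: apexes_def arc_iff verts_level_graph numeral_eq_Suc cell_square_def pf_vec_def
            divide_simps intro: down)
    qed (use 3 that in auto)
  qed
  note main = this
  show thesis
  proof (cases "fst l \<le> fst j")
    case True
    thus ?thesis using main[of j l] assms that by blast
  next
    case False
    then obtain k where "apexes L i l \<inter> apexes L i j = {k}" "k \<in> verts G"
      "cell_square c i l k * cell_square c i j k = pf_vec k * (pf_vec i * pf_vec l * pf_vec j)"
      using main[of l j] assms by auto
    thus ?thesis by (intro that[of k]) (simp_all add: Int_commute mult_ac)
  qed
qed

lemma common_target:
  assumes "(i, j) \<in> arcs G" "(l, j) \<in> arcs G" "i \<noteq> l"
  obtains k where "apexes L i j \<inter> apexes L l j = {k}" "k \<in> verts G"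
    "cell_square c i j k * cell_square c l j k = pf_vec k * (pf_vec i * pf_vec j * pf_vec l)"
proof -
  have "\<exists>k. apexes L i j \<inter> apexes L l j = {k} \<and> k \<in> verts G \<and> 
    cell_square c i j k * cell_square c l j k = pf_vec k * (pf_vec i * pf_vec j * pf_vec l)"
    if "(i, j) \<in> arcs G" "(l, j) \<in> arcs G" "fst i \<le> fst l" "i \<noteq> l" for i l
    using that(1)
  proof (cases rule: arc_cases)
    case (1 a b)
    from that(2) show ?thesis
    proof (cases rule: arc_cases)
      case (2 a' b')
      show ?thesis using 1 2 c2_pos
        by (intro exI[of _ "(a + 1, b')"])
          (auto simp: apexes_def arc_iff verts_level_graph numeral_eq_Suc cell_square_def pf_vec_def
            divide_simps intro: down)
    next
      case (3 a' b')
      show ?thesis using 1 3 c2_pos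
        by (intro exI[of _ "(a, b + 1)"])
          (auto simp: apexes_def arc_iff verts_level_graph numeral_eq_Suc cell_square_def pf_vec_def
            divide_simps intro: down)
    qed (use 1 that in auto)
  next
    case (2 a b)
    from that(2) show ?thesis
      by (cases rule: arc_cases) (use 2 that in auto)
  next
    case (3 a b)
    from that(2) show ?thesis
    proof (cases rule: arc_cases)
      case (2 a' b')
      show ?thesis using 3 2 c2_pos
        by (intro exI[of _ "(a + 1, b)"])
          (auto simp: apexes_def arc_iff verts_level_graph numeral_eq_Suc cell_square_def pf_vec_def
            divide_simps intro: down)
    qed (use 3 that in auto)
  qed
  note main = this
  show thesis
  proof (cases "fst i \<le> fst l")
    case True
    thus ?thesis using main[of i l] assms that by blast
  next
    case False
    then obtain k where "apexes L l j \<inter> apexes L i j = {k}" "k \<in> verts G"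
      "cell_square c l j k * cell_square c i j k = pf_vec k * (pf_vec l * pf_vec j * pf_vec i)"
      using main[of l i] assms by auto
    thus ?thesis by (intro that[of k]) (simp_all add: Int_commute mult_ac)
  qed
qed


lemma arc_verts: "(i, j) \<in> arcs G \<Longrightarrow> i \<in> verts G \<and> j \<in> verts G"
  using wf_digraph.tail_in_verts[OF wf, of "(i, j)"] wf_digraph.head_in_verts[OF wf, of "(i, j)"]
  by simp

lemma perron_frobenius: "perron_frobenius G (qnum q 3) (A_eigvec q)"
proof -
  have v00: "(0, 0) \<in> verts G" using L2 by (simp add: verts_level_graph numeral_2_eq_2)
  have eig: "adj_eigen G (qnum q 3) (A_eigvec q)"
    unfolding adj_eigen_def A_eigvec_eq qnum_real
    using v00 pf_vec_pos[OF v00] pf_vec_eigen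
    by (auto simp flip: of_real_sum of_real_mult intro!: bexI[of _ "(0, 0)"])
  moreover have "cmod \<mu> \<le> cmod (qnum q 3)" if "finite (verts G)" "adj_eigen G \<mu> \<psi>" for \<mu> \<psi>
    using positive_eigenvector_dominates[OF that(1) wf pf_vec_pos pf_vec_eigen that(2)]
    by (simp add: qnum_real)
  ultimately show ?thesis
    unfolding perron_frobenius_def using pf_vec_pos by (auto simp: A_eigvec_eq)
qed

text \<open>For edges \<open>i1 \<rightarrow> i2\<close>, \<open>i3 \<rightarrow> i2\<close>, \<open>i3 \<rightarrow> i4\<close>, \<open>i1 \<rightarrow> i4\<close>, lemma \<open>no_alternating_square\<close> leaves three cases for
the type II relation: all edges equal (\<open>cell_fourth_sum\<close>), or two different edges with the same source
(\<open>common_source\<close>) or with the same target (\<open>common_target\<close>).\<close>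

lemma cell_is_cell_system: "cell_system G q (A_eigvec q) (cell c)"
proof -
  interpret wf_digraph G by (rule wf)
  show ?thesis
  proof
    fix i show "finite (out_arcs G i) \<and> finite (in_arcs G i)" by (rule finite_arcs_at)
  next
    show "perron_frobenius G (qnum q 3) (A_eigvec q)" by (rule perron_frobenius)
  next
    fix \<alpha> \<beta> \<gamma> show "cell c (\<beta>, \<gamma>, \<alpha>) = cell c (\<alpha>, \<beta>, \<gamma>)"
      by (simp add: cell_def cell_square_rotate)
  next
    fix i j \<alpha> \<alpha>'
    assume "\<alpha> \<in> arcs_between G i j" "\<alpha>' \<in> arcs_between G i j"
    hence \<alpha>: "\<alpha> = (i, j)" "\<alpha>' = (i, j)" and arc: "(i, j) \<in> arcs G"
      by (auto simp: in_arcs_between)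
    have nn: "0 \<le> cell_square c i j k" for k
      using cell_square_nonneg arc_verts[OF arc] by blast
    have "(\<Sum>k\<in>apexes L i j. cell c (tri i j k) * cnj (cell c (tri i j k))) =
        of_real (\<Sum>k\<in>apexes L i j. cell_square c i j k)"
      using nn by (simp add: cell_tri flip: of_real_mult)
    thus "(\<Sum>(k, \<beta>, \<gamma>) \<in> {(k, \<beta>, \<gamma>). \<beta> \<in> arcs_between G j k \<and> \<gamma> \<in> arcs_between G k i}.
            cell c (\<alpha>, \<beta>, \<gamma>) * cnj (cell c (\<alpha>', \<beta>, \<gamma>)))
          = of_bool (\<alpha> = \<alpha>') * qnum q 2 * A_eigvec q i * A_eigvec q j"
      unfolding sum_over_apexes \<alpha> by (simp add: cell_square_sum[OF arc] qnum_real A_eigvec_eq)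
  next
    fix i1 i2 i3 i4 \<alpha>1 \<alpha>2 \<alpha>3 \<alpha>4
    assume "\<alpha>1 \<in> arcs_between G i1 i2" "\<alpha>2 \<in> arcs_between G i3 i2"
      "\<alpha>3 \<in> arcs_between G i3 i4" "\<alpha>4 \<in> arcs_between G i1 i4"
    hence \<alpha>: "\<alpha>1 = (i1, i2)" "\<alpha>2 = (i3, i2)" "\<alpha>3 = (i3, i4)" "\<alpha>4 = (i1, i4)"
      and arcs: "(i1, i2) \<in> arcs G" "(i3, i2) \<in> arcs G" "(i3, i4) \<in> arcs G" "(i1, i4) \<in> arcs G"
      by (auto simp: in_arcs_between)
    define A where "A = apexes L i1 i2 \<inter> apexes L i3 i4"
    define s where "s = (\<lambda>i j k. sqrt (cell_square c i j k))"
    have sq: "s i j k * s i j k = cell_square c i j k" if "i \<in> {i1, i3}" for i j k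
    proof -
      have "0 \<le> cell_square c i j k"
        by (rule cell_square_nonneg) (use that arc_verts[OF arcs(1)] arc_verts[OF arcs(3)] in auto)
      thus ?thesis by (simp add: s_def)
    qed
    have cancel: "inverse f * (x * y) = F" if "x * y = f * F" "0 < f" for f x y F :: real
      using that by (simp add: field_simps)
    have four: "(\<Sum>k\<in>A. inverse (pf_vec k) * s i1 i2 k * s i3 i2 k * s i3 i4 k * s i1 i4 k) =
       of_bool (i2 = i4) * pf_vec i1 * pf_vec i2 * pf_vec i3 +
       of_bool (i1 = i3) * pf_vec i1 * pf_vec i2 * pf_vec i4"
    proof (cases "i1 = i3")
      case i13: True
      show ?thesis
      proof (cases "i2 = i4")
        case True
        have "inverse (pf_vec k) * s i1 i2 k * s i1 i2 k * s i1 i2 k * s i1 i2 k =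
            (cell_square c i1 i2 k)\<^sup>2 / pf_vec k" for k
          unfolding sq[of i1, simplified, symmetric] by (simp add: power2_eq_square divide_inverse mult_ac)
        thus ?thesis using cell_fourth_sum[OF arcs(1)]
          by (simp add: A_def i13 True distrib_left mult_ac)
      next
        case False
        obtain k where k: "A = {k}" "k \<in> verts G"
          "cell_square c i1 i2 k * cell_square c i1 i4 k = pf_vec k * (pf_vec i1 * pf_vec i2 * pf_vec i4)"
          unfolding A_def using common_source[OF arcs(1,4) False] i13 by metis
        have "inverse (pf_vec k) * s i1 i2 k * s i1 i2 k * s i1 i4 k * s i1 i4 k =
            pf_vec i1 * pf_vec i2 * pf_vec i4"
          using cancel[OF k(3) pf_vec_pos[OF k(2)]] by (simp add: mult_ac flip: sq)
        thus ?thesis using False i13 by (simp add: k(1))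
      qed
    next
      case False
      hence i24: "i2 = i4" using no_alternating_square[OF arcs] by blast
      obtain k where k: "A = {k}" "k \<in> verts G"
        "cell_square c i1 i2 k * cell_square c i3 i2 k = pf_vec k * (pf_vec i1 * pf_vec i2 * pf_vec i3)"
        unfolding A_def using common_target[OF arcs(1,2) False] i24 by metis
      have "inverse (pf_vec k) * s i1 i2 k * s i3 i2 k * s i3 i2 k * s i1 i2 k =
          pf_vec i1 * pf_vec i2 * pf_vec i3"
        using cancel[OF k(3) pf_vec_pos[OF k(2)]] by (simp add: mult_ac flip: sq)
      thus ?thesis using False i24 by (simp add: k(1))
    qed
    have cell_s: "cell c ((i, j), (j, k), (k, i)) = of_real (s i j k)" for i j k
      by (simp add: cell_tri s_def)
    have "(\<Sum>k\<in>A. inverse (A_eigvec q k) * cell c (tri i1 i2 k) * cnj (cell c (tri i3 i2 k)) *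
              cell c (tri i3 i4 k) * cnj (cell c (tri i1 i4 k))) =
      of_real (\<Sum>k\<in>A. inverse (pf_vec k) * s i1 i2 k * s i3 i2 k * s i3 i4 k * s i1 i4 k)"
      by (simp add: cell_s A_eigvec_eq)
    also note four
    finally show "(\<Sum>(k, \<beta>\<^sub>1, \<beta>\<^sub>2, \<beta>\<^sub>3, \<beta>\<^sub>4) \<in> {(k, \<beta>\<^sub>1, \<beta>\<^sub>2, \<beta>\<^sub>3, \<beta>\<^sub>4).
              \<beta>\<^sub>1 \<in> arcs_between G i2 k \<and> \<beta>\<^sub>2 \<in> arcs_between G k i1 \<and>
              \<beta>\<^sub>3 \<in> arcs_between G k i3 \<and> \<beta>\<^sub>4 \<in> arcs_between G i4 k}.
            inverse (A_eigvec q k) * cell c (\<alpha>1, \<beta>\<^sub>1, \<beta>\<^sub>2) * cnj (cell c (\<alpha>2, \<beta>\<^sub>1, \<beta>\<^sub>3)) *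
              cell c (\<alpha>3, \<beta>\<^sub>4, \<beta>\<^sub>3) * cnj (cell c (\<alpha>4, \<beta>\<^sub>4, \<beta>\<^sub>2)))
          = of_bool (\<alpha>1 = \<alpha>4) * of_bool (\<alpha>2 = \<alpha>3) * A_eigvec q i1 * A_eigvec q i2 * A_eigvec q i3 +
            of_bool (\<alpha>1 = \<alpha>2) * of_bool (\<alpha>3 = \<alpha>4) * A_eigvec q i1 * A_eigvec q i2 * A_eigvec q i4"
      unfolding sum_over_common_apexes A_def[symmetric] \<alpha>
      by (auto simp: A_eigvec_eq)
  qed
qed

lemma cell_given_by_formulas: "given_by_formulas G q (cell c)"
proof -
  have root: "complex_of_real (sqrt (x / (c 2)\<^sup>2)) = csqrt (of_real x) / of_real (c 2)"
    if "0 \<le> x / (c 2)\<^sup>2" for x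
  proof -
    have "0 \<le> x" using that c2_pos by (simp add: zero_le_divide_iff)
    thus ?thesis using c2_pos by (simp add: real_sqrt_divide)
  qed
  show ?thesis unfolding given_by_formulas_def
  proof (intro allI conjI impI)
    fix k m assume "up_triangle k m \<in> triangles G"
    hence "(k, m) \<in> verts G" using level_le[of "k + m + 3" "k + m + 2"]
      by (simp add: up_in_triangles verts_level_graph)
    from root[OF cell_square_nonneg[OF this, of "(k + 1, m)" "(k, m + 1)", unfolded cell_square_up]]
    show "cell c (up_triangle k m) =
        csqrt (qnum q (k + 1) * qnum q (k + 2) * qnum q (m + 1) * qnum q (m + 2) *
               qnum q (k + m + 2) * qnum q (k + m + 3)) / qnum q 2"
      by (simp only: up_triangle_eq cell_tri cell_square_up qnum_real of_real_mult)
  next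
    fix k m assume "down_triangle k m \<in> triangles G"
    hence "(k + 1, m) \<in> verts G" using level_le[of "k + m + 4" "k + m + 3"]
      by (simp add: down_in_triangles verts_level_graph numeral_eq_Suc)
    from root[OF cell_square_nonneg[OF this, of "(k, m + 1)" "(k + 1, m + 1)", unfolded cell_square_down]]
    show "cell c (down_triangle k m) =
        csqrt (qnum q (k + 1) * qnum q (k + 2) * qnum q (m + 1) * qnum q (m + 2) *
               qnum q (k + m + 3) * qnum q (k + m + 4)) / qnum q 2"
      by (simp only: down_triangle_eq cell_tri cell_square_down qnum_real of_real_mult)
  qed
qed

end

section \<open>Uniqueness\<close>

context level_set
begin

lemma cell_system_rotate:
  assumes "cell_system G q \<phi> W" "tri i j k \<in> triangles G"
  shows "W (tri j k i) = W (tri i j k)" "W (tri k i j) = W (tri i j k)"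
proof -
  interpret cell_system G q \<phi> W by fact
  have "tri j k i \<in> triangles G" using assms(2) by (auto simp: in_triangles_iff)
  from rotate[OF this] rotate[OF assms(2)]
  show "W (tri j k i) = W (tri i j k)" "W (tri k i j) = W (tri i j k)" by simp_all
qed

lemma cell_system_apex_sum:
  assumes "cell_system G q \<phi> W" "(i, j) \<in> arcs G"
  shows "(\<Sum>k\<in>apexes L i j. of_real ((cmod (W (tri i j k)))\<^sup>2)) = qnum q 2 * \<phi> i * \<phi> j"
proof -
  interpret cell_system G q \<phi> W by fact
  have "(i, j) \<in> arcs_between G i j" using assms(2) by (simp add: in_arcs_between)
  from type_I[OF this this] show ?thesis
    unfolding sum_over_apexes by (simp add: complex_norm_square del: of_real_power)
qed

text \<open>The type I relation alone determines the moduli. The edge \<open>(k, 0) \<rightarrow> (k + 1, 0)\<close> lies on only one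
triangle. From there one moves up through the strip of triangles over it, where each new triangle
shares an edge with the previous one and that edge lies on no other triangle.\<close>

lemma cell_system_moduli:
  assumes W: "cell_system G q \<phi> W" and V: "cell_system G q \<phi> V"
  shows "L (k + m + 3) \<Longrightarrow> cmod (W (up_triangle k m)) = cmod (V (up_triangle k m))"
    and "L (k + m + 4) \<Longrightarrow> cmod (W (down_triangle k m)) = cmod (V (down_triangle k m))"
proof -
  have sums: "(\<Sum>k\<in>apexes L i j. (cmod (W (tri i j k)))\<^sup>2) = (\<Sum>k\<in>apexes L i j. (cmod (V (tri i j k)))\<^sup>2)"
    if "(i, j) \<in> arcs G" for i j
    using trans[OF cell_system_apex_sum[OF W that] cell_system_apex_sum[OF V that, symmetric]]
    by (simp only: of_real_eq_iff flip: of_real_sum)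
  have down_of_up: "cmod (W (down_triangle k m)) = cmod (V (down_triangle k m))"
    if L: "L (k + m + 4)" and up: "cmod (W (up_triangle k m)) = cmod (V (up_triangle k m))" for m
  proof -
    have L3: "L (k + m + 3)" using level_le[OF L] by simp
    have arc: "((k + 1, m), (k, m + 1)) \<in> arcs G" using L3 by (simp add: arc_iff numeral_eq_Suc)
    have "tri (k, m) (k + 1, m) (k, m + 1) \<in> triangles G"
      using L3 up_in_triangles by (simp add: up_triangle_def)
    from cell_system_rotate(1)[OF W this] cell_system_rotate(1)[OF V this] up sums[OF arc] L
    show ?thesis unfolding sum_apexes_2[OF L3] up_triangle_eq down_triangle_eq by simp
  qed
  have up: "cmod (W (up_triangle k m)) = cmod (V (up_triangle k m))" if "L (k + m + 3)" for m
    using that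
  proof (induction m)
    case 0
    have "((k, 0), (k + 1, 0)) \<in> arcs G" using 0 level_le[OF 0] by (simp add: arc_iff numeral_eq_Suc)
    from sums[OF this] show ?case unfolding sum_apexes_1[OF 0] up_triangle_eq by simp
  next
    case (Suc m)
    have L4: "L (k + m + 4)" and L3: "L (k + m + 3)"
      using Suc.prems level_le[OF Suc.prems] by (simp_all add: numeral_eq_Suc)
    note d = down_of_up[OF L4 Suc.IH[OF L3]]
    have arc: "((k, Suc m), (k + 1, Suc m)) \<in> arcs G"
      using Suc.prems L3 by (simp add: arc_iff numeral_eq_Suc)
    have "tri (k + 1, m) (k, m + 1) (k + 1, m + 1) \<in> triangles G"
      using L4 down_in_triangles by (simp add: down_triangle_def)
    from cell_system_rotate(1)[OF W this] cell_system_rotate(1)[OF V this] d sums[OF arc]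
    show ?case unfolding sum_apexes_1[OF Suc.prems] up_triangle_eq down_triangle_eq by simp
  qed
  show "L (k + m + 3) \<Longrightarrow> cmod (W (up_triangle k m)) = cmod (V (up_triangle k m))" by (rule up)
  show "L (k + m + 4) \<Longrightarrow> cmod (W (down_triangle k m)) = cmod (V (down_triangle k m))"
    using down_of_up up level_le[of "k + m + 4" "k + m + 3"] by simp
qed

end

text \<open>The value 1 off the triangles, and where both cells vanish, makes the phase unimodular everywhere.\<close>

definition phase ::
  "(nat \<Rightarrow> bool) \<Rightarrow> (edge \<times> edge \<times> edge \<Rightarrow> complex) \<Rightarrow>
   (edge \<times> edge \<times> edge \<Rightarrow> complex) \<Rightarrow> edge \<times> edge \<times> edge \<Rightarrow> complex" where
  "phase L W V t = (if t \<in> triangles (level_graph L) \<and> V t \<noteq> 0 then W t / V t else 1)"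

text \<open>The phases are removed strip by strip: give vertical edges the phase 1. In the strip over
\<open>(k, 0) \<rightarrow> (k + 1, 0)\<close> the triangles are then glued in a chain along horizontal and diagonal edges, so
that the phase of each such edge is forced by the previous one and by the triangle between them.\<close>

fun edge_phase_1 :: "(edge \<times> edge \<times> edge \<Rightarrow> complex) \<Rightarrow> nat \<Rightarrow> nat \<Rightarrow> complex" where
  "edge_phase_1 \<theta> k 0 = 1"
| "edge_phase_1 \<theta> k (Suc m) = \<theta> (down_triangle k m) * edge_phase_1 \<theta> k m / \<theta> (up_triangle k m)"

definition edge_phase :: "(edge \<times> edge \<times> edge \<Rightarrow> complex) \<Rightarrow> edge \<Rightarrow> complex" where
  "edge_phase \<theta> = (\<lambda>((a, b), (a', b')).
     if a' = a + 1 then edge_phase_1 \<theta> a b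
     else if a = a' + 1 then \<theta> (up_triangle a' b) / edge_phase_1 \<theta> a' b else 1)"

context level_set
begin

lemma cell_equivalentI_diagonal:
  assumes "\<And>e. cmod (u e) = 1"
    and "\<And>i j k. tri i j k \<in> triangles G \<Longrightarrow> W (tri i j k) = u (i, j) * u (j, k) * u (k, i) * V (tri i j k)"
  shows "cell_equivalent G W V"
  unfolding cell_equivalent_def
proof (intro exI[of _ "\<lambda>\<sigma> _. u \<sigma>"] conjI ballI allI impI)
  fix i j
  have "u e * cnj (u e) = 1" for e using complex_norm_square[of "u e"] assms(1)[of e] by simp
  thus "unitary_on (arcs_between G i j) (\<lambda>\<sigma> _. u \<sigma>)"
    by (auto simp: unitary_on_def arcs_between_eq mult.commute)
next
  fix i j k \<sigma> \<rho> \<gamma>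
  assume "\<sigma> \<in> arcs_between G i j" "\<rho> \<in> arcs_between G j k" "\<gamma> \<in> arcs_between G k i"
  hence e: "\<sigma> = (i, j)" "\<rho> = (j, k)" "\<gamma> = (k, i)"
    and arcs: "(i, j) \<in> arcs G" "(j, k) \<in> arcs G" "(k, i) \<in> arcs G"
    by (auto simp: in_arcs_between)
  have "tri i j k \<in> triangles G" using arcs by (auto simp: in_triangles_iff)
  from assms(2)[OF this] arcs
  show "W (\<sigma>, \<rho>, \<gamma>) = (\<Sum>\<sigma>'\<in>arcs_between G i j. \<Sum>\<rho>'\<in>arcs_between G j k. \<Sum>\<gamma>'\<in>arcs_between G k i.
             u \<sigma> * u \<rho> * u \<gamma> * V (\<sigma>', \<rho>', \<gamma>'))"
    by (simp add: e arcs_between_eq)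
qed

text \<open>Two cell systems have the same moduli, so on each triangle they differ by a phase. Since the
triangles form chains along strips, these phases are products of edge phases.\<close>

lemma cell_systems_equivalent:
  assumes W: "cell_system G q \<phi> W" and V: "cell_system G q \<phi> V"
  shows "cell_equivalent G W V"
proof -
  define \<theta> where "\<theta> = phase L W V"
  define u where "u = edge_phase \<theta>"
  have \<theta>_up: "cmod (\<theta> (up_triangle k m)) = 1" for k m
    using cell_system_moduli(1)[OF W V, of k m] by (auto simp: \<theta>_def phase_def norm_divide up_in_triangles)
  have \<theta>_down: "cmod (\<theta> (down_triangle k m)) = 1" for k m
    using cell_system_moduli(2)[OF W V, of k m] by (auto simp: \<theta>_def phase_def norm_divide down_in_triangles)
  have phase_1: "cmod (edge_phase_1 \<theta> k m) = 1" for k m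
    by (induction m) (simp_all add: norm_mult norm_divide \<theta>_up \<theta>_down)
  hence ne: "edge_phase_1 \<theta> k m \<noteq> 0" for k m by (metis norm_zero zero_neq_one)
  have ne_up: "\<theta> (up_triangle k m) \<noteq> 0" for k m using \<theta>_up by (metis norm_zero zero_neq_one)
  have unit: "cmod (u e) = 1" for e
    by (cases e) (auto simp: u_def edge_phase_def norm_divide \<theta>_up phase_1)
  have holonomy: "W t = \<theta> t * V t" if "t \<in> triangles G" "cmod (W t) = cmod (V t)" for t
    using that by (cases "V t = 0") (simp_all add: \<theta>_def phase_def)
  show ?thesis
  proof (rule cell_equivalentI_diagonal[of u])
    show "cmod (u e) = 1" for e by (rule unit)
    have up: "u (i, j) * u (j, l) * u (l, i) = \<theta> (tri i j l)" if "up_triangle k m = tri i j l" for i j l k m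
    proof -
      have "u ((k, m), (k + 1, m)) * u ((k + 1, m), (k, m + 1)) * u ((k, m + 1), (k, m)) =
          \<theta> (up_triangle k m)"
        using ne[of k m] by (simp add: u_def edge_phase_def)
      thus ?thesis using that by (simp add: up_triangle_eq)
    qed
    have dn: "u (i, j) * u (j, l) * u (l, i) = \<theta> (tri i j l)" if "down_triangle k m = tri i j l" for i j l k m
    proof -
      have "u ((k + 1, m), (k, m + 1)) * u ((k, m + 1), (k + 1, m + 1)) * u ((k + 1, m + 1), (k + 1, m)) =
          \<theta> (down_triangle k m)"
        using ne[of k m] ne_up[of k m] by (simp add: u_def edge_phase_def)
      thus ?thesis using that by (simp add: down_triangle_eq)
    qed
    fix i j k assume t: "tri i j k \<in> triangles G"
    have rot: "tri j k i \<in> triangles G" "tri k i j \<in> triangles G"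
      using t by (auto simp: in_triangles_iff)
    note cyc = cell_system_rotate[OF W t] cell_system_rotate[OF V t]
    from t show "W (tri i j k) = u (i, j) * u (j, k) * u (k, i) * V (tri i j k)"
    proof (cases rule: triangle_cases)
      case (1 a b x y z)
      have "W (tri x y z) = u (x, y) * u (y, z) * u (z, x) * V (tri x y z)"
        using holonomy[of "tri x y z"] cell_system_moduli(1)[OF W V 1(1)] up[OF 1(2)] 1 up_in_triangles[of a b]
        by simp
      with 1(3) cyc show ?thesis by (auto simp: mult_ac)
    next
      case (2 a b x y z)
      have "W (tri x y z) = u (x, y) * u (y, z) * u (z, x) * V (tri x y z)"
        using holonomy[of "tri x y z"] cell_system_moduli(2)[OF W V 2(1)] dn[OF 2(2)] 2 down_in_triangles[of a b]
        by simp
      with 2(3) cyc show ?thesis by (auto simp: mult_ac)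
    qed
  qed
qed

end

section \<open>The two families of quantum numbers\<close>

lemma qnum_root_of_unity:
  assumes "n \<ge> 4" "q = exp (complex_of_real pi * \<i> / of_nat n)"
  shows "qnum q m = of_real (sin (real m * pi / real n) / sin (pi / real n))"
proof -
  have q: "q = cis (pi / real n)" using assms(2) by (simp add: cis_conv_exp mult.commute)
  have s: "sin (pi / real n) > 0" using assms(1) by (intro sin_gt_zero) (auto simp: field_simps)
  have pow: "q ^ k - inverse q ^ k = 2 * \<i> * of_real (sin (real k * pi / real n))" for k
    by (simp add: q DeMoivre complex_eq_iff)
  have "q \<noteq> 1" using s by (auto simp: q complex_eq_iff)
  thus ?thesis using s pow[of m] pow[of 1] by (simp add: qnum_def)
qed

lemma quantum_level_set_root_of_unity:
  assumes "n \<ge> 4" and q: "q = exp (complex_of_real pi * \<i> / of_nat n)"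
  shows "quantum_level_set (\<lambda>s. s < n) q (\<lambda>m. sin (real m * pi / real n) / sin (pi / real n))"
proof
  have s: "sin (real m * pi / real n) > 0" if "m < n" "0 < m" for m
    using that by (intro sin_gt_zero) (auto simp: field_simps)
  have s1: "sin (pi / real n) > 0" using s[of 1] assms(1) by simp
  show "q \<noteq> 0" by (simp add: q)
  have "q = cis (pi / real n)" using q by (simp add: cis_conv_exp mult.commute)
  thus "q \<noteq> - 1" using s1 by (auto simp: complex_eq_iff)
  show "qnum q m = of_real (sin (real m * pi / real n) / sin (pi / real n))" for m
    by (rule qnum_root_of_unity[OF assms])
  show "0 < sin (real m * pi / real n) / sin (pi / real n)" if "m < n" "0 < m" for m
    using s[OF that] s1 by simp
  show "sin (real (Suc m) * pi / real n) / sin (pi / real n) = 0" if "m < n" "\<not> Suc m < n" for m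
  proof -
    have "Suc m = n" using that by simp
    thus ?thesis using assms(1) by simp
  qed
qed (use assms(1) in auto)

text \<open>As \<open>[2] = 2 cosh x\<close> is at least 2, the recursion makes the increments \<open>[m + 1] - [m]\<close> nondecreasing,
starting from 1; hence all \<open>[m]\<close> with \<open>m > 0\<close> are positive.\<close>

lemma quantum_level_set_exp:
  assumes q: "q = complex_of_real (exp x)"
  shows "quantum_level_set (\<lambda>s. True) q (\<lambda>m. Re (qnum q m))"
proof
  show q0: "q \<noteq> 0" by (simp add: q)
  have "Re q > 0" by (simp add: q)
  thus q1: "q \<noteq> - 1" by auto
  have "qnum q m \<in> \<real>" for m
    unfolding q qnum_def by (auto intro!: Reals_divide Reals_diff Reals_power Reals_inverse)
  thus real: "qnum q m = of_real (Re (qnum q m))" for m by simp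
  define c where "c = (\<lambda>m. Re (qnum q m))"
  have two: "c 2 \<ge> 2"
  proof -
    have sum: "q + inverse q = of_real (exp x + exp (- x))" by (simp add: q exp_minus)
    have "c 2 = exp x + exp (- x)"
      using sum by (simp add: c_def qnum_2[OF q0 q1])
    also have "\<dots> = 2 * cosh x" by (simp add: cosh_field_def)
    finally show ?thesis using cosh_real_ge_1[of x] by simp
  qed
  have rec: "c (m + 2) = c 2 * c (m + 1) - c m" for m
    using qnum_rec[OF q0 q1, of m] real[of 2] unfolding c_def
    by (metis Re_complex_of_real of_real_diff of_real_mult real)
  have growth: "0 \<le> c m \<and> c m < c (m + 1)" for m
  proof (induction m)
    case 0 show ?case using qnum_1[OF q0 q1] by (simp add: c_def qnum_0)
  next
    case (Suc m)
    hence h: "0 \<le> c m" "c m < c (Suc m)" by auto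
    hence "2 * c (Suc m) \<le> c 2 * c (Suc m)" using two by (intro mult_right_mono) auto
    moreover have "c (Suc m + 1) = c 2 * c (Suc m) - c m" using rec[of m] by simp
    ultimately show ?case using h by (intro conjI) linarith+
  qed
  show "0 < Re (qnum q m)" if "0 < m" for m
    using growth[of "m - 1"] that by (simp add: c_def)
qed auto

text \<open>Because \<open>[3] = [2]\<^sup>2 - 1\<close>, one has to solve \<open>2 cosh x = sqrt (\<alpha> + 1)\<close>, where the right side is at least 2.\<close>

lemma qnum_3_surj:
  assumes "\<alpha> \<ge> 3"
  shows "\<exists>x. complex_of_real \<alpha> = qnum (complex_of_real (exp x)) 3"
proof -
  define s where "s = sqrt (\<alpha> + 1) / 2"
  have s: "s \<ge> 1" using assms real_sqrt_le_mono[of 4 "\<alpha> + 1"] by (simp add: s_def)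
  define x where "x = arcosh s"
  define q where "q = complex_of_real (exp x)"
  have q: "q \<noteq> 0" "q \<noteq> - 1"
  proof -
    have "Re q > 0" by (simp add: q_def)
    thus "q \<noteq> 0" "q \<noteq> - 1" by auto
  qed
  have "qnum q 2 = of_real (2 * cosh x)"
    unfolding qnum_2[OF q] by (simp add: q_def cosh_field_def exp_minus)
  hence 2: "qnum q 2 = of_real (2 * s)" using s by (simp add: x_def cosh_arcosh_real)
  have "qnum q 3 = (qnum q 2)\<^sup>2 - 1"
    using qnum_rec[OF q, of 1] qnum_1[OF q] by (simp add: numeral_eq_Suc power2_eq_square)
  also have "\<dots> = of_real ((2 * s)\<^sup>2 - 1)" by (simp add: 2)
  also have "(2 * s)\<^sup>2 - 1 = \<alpha>" using assms by (simp add: s_def)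
  finally show ?thesis unfolding q_def by metis
qed

theorem theorem5p1:
  shows "(\<forall>n\<ge>4. \<forall>q. q = exp (complex_of_real pi * \<i> / of_nat n) \<longrightarrow>
           (\<exists>W. cell_system (A_fin n) q (A_eigvec q) W \<and>
                given_by_formulas (A_fin n) q W \<and>
                (\<forall>W'. cell_system (A_fin n) q (A_eigvec q) W' \<longrightarrow>
                   cell_equivalent (A_fin n) W' W))) \<and>
         (\<forall>\<alpha>::real. \<alpha> \<ge> 3 \<longrightarrow>
           (\<exists>x::real. complex_of_real \<alpha> = qnum (complex_of_real (exp x)) 3) \<and>
           (\<forall>x::real. \<forall>q. q = complex_of_real (exp x) \<longrightarrow> complex_of_real \<alpha> = qnum q 3 \<longrightarrow>
              (\<exists>W. cell_system A_inf q (A_eigvec q) W \<and> given_by_formulas A_inf q W)))"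
proof (intro conjI allI impI)
  fix n :: nat and q :: complex
  assume n: "n \<ge> 4" and q: "q = exp (complex_of_real pi * \<i> / of_nat n)"
  interpret quantum_level_set "\<lambda>s. s < n" q "\<lambda>m. sin (real m * pi / real n) / sin (pi / real n)"
    by (rule quantum_level_set_root_of_unity[OF n q])
  show "\<exists>W. cell_system (A_fin n) q (A_eigvec q) W \<and> given_by_formulas (A_fin n) q W \<and>
      (\<forall>W'. cell_system (A_fin n) q (A_eigvec q) W' \<longrightarrow> cell_equivalent (A_fin n) W' W)"
    unfolding A_fin_eq
    using cell_is_cell_system cell_given_by_formulas cell_systems_equivalent by blast
next
  fix \<alpha> :: real assume "\<alpha> \<ge> 3"
  thus "\<exists>x::real. complex_of_real \<alpha> = qnum (complex_of_real (exp x)) 3" by (rule qnum_3_surj)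
next
  fix x :: real and q :: complex
  assume q: "q = complex_of_real (exp x)"
  interpret quantum_level_set "\<lambda>s. True" q "\<lambda>m. Re (qnum q m)"
    by (rule quantum_level_set_exp[OF q])
  show "\<exists>W. cell_system A_inf q (A_eigvec q) W \<and> given_by_formulas A_inf q W"
    unfolding A_inf_eq using cell_is_cell_system cell_given_by_formulas by blast
qed

end
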